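(* For every even integer $g \geq 4$, there is a bipartite planar graph $G$ with girth $g$ such that $\operatorname{diam}(\mathcal{I}(G)) \geq 3$.
   Context: Graphs are finite and simple. The girth of a graph is the length of its shortest cycle. In an orientation $\vec{G}$ of a graph $G$, the inversion of a set $X \subseteq V(G)$ consists in reversing all arcs with both endvertices in $X$. The inversion graph $\mathcal{I}(G)$ is the graph whose vertices are the labelled orientations of $G$, two orientations being adjacent if and only if the inversion of some $X\subseteq V(G)$ transforms one into the other; $\operatorname{diam}(\mathcal{I}(G))$ is its diameter. *)

theory Defs
  imports "HOL-Analysis.Analysis" "HOL-Library.Extended_Nat"
begin

text \<open>A graph is a pair of a vertex set and a set of edges, each edge being a two-element set.\<close>

type_synonym 'a graph = "'a set \<times> 'a set set"

abbreviation verts :: "'a graph \<Rightarrow> 'a set" where "verts G \<equiv> fst G"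
abbreviation edges :: "'a graph \<Rightarrow> 'a set set" where "edges G \<equiv> snd G"

definition finite_simple_graph :: "'a graph \<Rightarrow> bool" where
  "finite_simple_graph G \<longleftrightarrow>
     finite (verts G) \<and> (\<forall>e\<in>edges G. e \<subseteq> verts G \<and> card e = 2)"

definition bipartite :: "'a graph \<Rightarrow> bool" where
  "bipartite G \<longleftrightarrow>
     (\<exists>A B. A \<union> B = verts G \<and> A \<inter> B = {} \<and>
            (\<forall>e\<in>edges G. \<exists>a\<in>A. \<exists>b\<in>B. e = {a, b}))"

text \<open>A cycle is given by its list of distinct vertices in cyclic order, so its length is the
  length of the list. The girth of an acyclic graph is \<open>\<infinity>\<close>, the infimum of the empty set.\<close>

definition is_cycle :: "'a graph \<Rightarrow> 'a list \<Rightarrow> bool" where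
  "is_cycle G p \<longleftrightarrow>
     length p \<ge> 3 \<and> distinct p \<and> set p \<subseteq> verts G \<and>
     (\<forall>i<length p. {p ! i, p ! ((i + 1) mod length p)} \<in> edges G)"

definition girth :: "'a graph \<Rightarrow> enat" where
  "girth G = (INF p\<in>{p. is_cycle G p}. enat (length p))"

text \<open>Planarity is the existence of a drawing in the plane: vertices are distinct points,
  and each edge is a simple arc joining the points of its two ends that meets the drawn vertices
  only there; two different arcs meet at most in the points of common ends.\<close>

definition planar :: "'a graph \<Rightarrow> bool" where
  "planar G \<longleftrightarrow>
     (\<exists>(pos :: 'a \<Rightarrow> complex) (\<gamma> :: 'a set \<Rightarrow> real \<Rightarrow> complex).
        inj_on pos (verts G) \<and>
        (\<forall>e\<in>edges G. arc (\<gamma> e) \<and> {pathstart (\<gamma> e), pathfinish (\<gamma> e)} = pos ` e \<and>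
                      path_image (\<gamma> e) \<inter> pos ` verts G = pos ` e) \<and>
        (\<forall>e\<in>edges G. \<forall>f\<in>edges G. e \<noteq> f \<longrightarrow>
           path_image (\<gamma> e) \<inter> path_image (\<gamma> f) \<subseteq> pos ` (e \<inter> f)))"

text \<open>A walk is given by its list of vertices, so it has one step fewer than its list has entries.
  Distances and diameters take the value \<open>\<infinity>\<close> when there is no connecting walk.\<close>

definition is_walk :: "'a graph \<Rightarrow> 'a \<Rightarrow> 'a list \<Rightarrow> 'a \<Rightarrow> bool" where
  "is_walk G u p v \<longleftrightarrow>
     p \<noteq> [] \<and> hd p = u \<and> last p = v \<and> set p \<subseteq> verts G \<and>
     (\<forall>i. i + 1 < length p \<longrightarrow> {p ! i, p ! (i + 1)} \<in> edges G)"

definition graph_dist :: "'a graph \<Rightarrow> 'a \<Rightarrow> 'a \<Rightarrow> enat" where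
  "graph_dist G u v = (INF p\<in>{p. is_walk G u p v}. enat (length p - 1))"

definition graph_diam :: "'a graph \<Rightarrow> enat" where
  "graph_diam G = (SUP u\<in>verts G. SUP v\<in>verts G. graph_dist G u v)"

text \<open>An orientation is the set of its arcs; it contains exactly one of \<open>(u, v)\<close> and \<open>(v, u)\<close>
  for each edge \<open>{u, v}\<close>. Orientations are labelled: they are compared as sets of arcs, not up
  to isomorphism.\<close>

definition orientation :: "'a graph \<Rightarrow> ('a \<times> 'a) set \<Rightarrow> bool" where
  "orientation G D \<longleftrightarrow>
     (\<forall>u v. (u, v) \<in> D \<longrightarrow> {u, v} \<in> edges G) \<and>
     (\<forall>u v. {u, v} \<in> edges G \<longrightarrow> ((u, v) \<in> D \<longleftrightarrow> (v, u) \<notin> D))"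

definition inversion :: "'a set \<Rightarrow> ('a \<times> 'a) set \<Rightarrow> ('a \<times> 'a) set" where
  "inversion X D = {(u, v). if u \<in> X \<and> v \<in> X then (v, u) \<in> D else (u, v) \<in> D}"

definition inversion_graph :: "'a graph \<Rightarrow> ('a \<times> 'a) set graph" where
  "inversion_graph G =
     ({D. orientation G D},
      {{D, D'} | D D'. orientation G D \<and> orientation G D' \<and> D \<noteq> D' \<and>
                       (\<exists>X \<subseteq> verts G. inversion X D = D')})"

end

theory Submission imports Defs begin

text \<open>
  Take a cycle of length \<open>g\<close> with a pendant edge at each of its vertices, and two orientations that
  differ on the pendant edges and on exactly one edge of the cycle. If inverting \<open>X\<close> and then \<open>Y\<close>
  turns one into the other, then an edge is reversed iff its ends lie together in exactly one of
  \<open>X\<close> and \<open>Y\<close>. The pendant edges put each vertex of the cycle in \<open>X \<union> Y\<close>. Along an edge that is not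
  reversed, the roles of \<open>X\<close> and \<open>Y\<close> are therefore swapped, and after the odd number \<open>g - 1\<close> of such
  edges the remaining edge of the cycle cannot be reversed either.
\<close>

section \<open>Distances in the inversion graph\<close>

lemma inversion_inversion [simp]: "inversion X (inversion X D) = D"
  by (auto simp: inversion_def split: if_splits)

lemma inversion_empty [simp]: "inversion {} D = D"
  by (auto simp: inversion_def)

text \<open>Edges are unordered, but inversion is an involution, so the same \<open>X\<close> serves
  in both directions.\<close>

lemma inversion_graph_edgeE:
  assumes "{D, D'} \<in> edges (inversion_graph G)"
  obtains X where "X \<subseteq> verts G" "inversion X D = D'"
proof -
  obtain C C' X where C: "{D, D'} = {C, C'}" "X \<subseteq> verts G" "inversion X C = C'"
    using assms by (auto simp: inversion_graph_def)
  then have "inversion X D = D'"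
    by (auto simp: doubleton_eq_iff)
  with C(2) that show ?thesis by blast
qed

text \<open>A walk with at most two steps amounts to two successive inversions, because missing
  steps can be filled in by inverting \<open>{}\<close>.\<close>

lemma graph_dist_inversion_graph_ge_3:
  assumes "\<And>X Y. inversion Y (inversion X D) \<noteq> D'"
  shows "graph_dist (inversion_graph G) D D' \<ge> 3"
proof -
  let ?I = "inversion_graph G"
  have "3 \<le> enat (length p - 1)" if p: "is_walk ?I D p D'" for p
  proof (rule ccontr)
    assume "\<not> 3 \<le> enat (length p - 1)"
    then have short: "length p \<le> 3"
      by (auto simp: numeral_eq_enat)
    have ends: "p \<noteq> []" "p ! 0 = D" "p ! (length p - 1) = D'"
      and step: "\<And>i. i + 1 < length p \<Longrightarrow> {p ! i, p ! (i + 1)} \<in> edges ?I"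
      using p by (auto simp: is_walk_def hd_conv_nth last_conv_nth)
    consider "length p = 1" | "length p = 2" | "length p = 3"
      using ends(1) short by (cases p) (auto simp: le_Suc_eq numeral_eq_Suc)
    then show False
    proof cases
      case 1
      with ends assms[of "{}" "{}"] show False by simp
    next
      case 2
      then have "{D, D'} \<in> edges ?I"
        using step[of 0] ends by simp
      then obtain X where "inversion X D = D'"
        by (rule inversion_graph_edgeE)
      with assms[of "{}" X] show False by simp
    next
      case 3
      then have "{D, p ! 1} \<in> edges ?I" "{p ! 1, D'} \<in> edges ?I"
        using step[of 0] step[of 1] ends by (simp_all add: numeral_2_eq_2)
      then obtain X Y where "inversion X D = p ! 1" "inversion Y (p ! 1) = D'"
        by (metis inversion_graph_edgeE)
      with assms[of Y X] show False by simp
    qed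
  qed
  then show ?thesis
    unfolding graph_dist_def by (intro INF_greatest) simp
qed

section \<open>Cycles and drawings\<close>

text \<open>The predecessor and the successor of \<open>v\<close> on the cycle differ because the
  length is at least 3. This keeps leaves off cycles.\<close>

lemma is_cycle_two_neighbours:
  assumes "is_cycle G p" "v \<in> set p"
  obtains a b where "a \<noteq> b" "a \<in> set p" "b \<in> set p" "{v, a} \<in> edges G" "{v, b} \<in> edges G"
proof -
  let ?n = "length p"
  have n: "?n \<ge> 3" and d: "distinct p"
    and e: "\<And>i. i < ?n \<Longrightarrow> {p ! i, p ! ((i + 1) mod ?n)} \<in> edges G"
    using assms(1) by (auto simp: is_cycle_def)
  obtain i where i: "i < ?n" "v = p ! i"
    using assms(2) by (auto simp: in_set_conv_nth)
  define j where "j = (if i = 0 then ?n - 1 else i - 1)"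
  have j: "j < ?n" "(j + 1) mod ?n = i"
    using i n by (auto simp: j_def)
  have k: "(i + 1) mod ?n < ?n"
    using n by (intro mod_less_divisor) linarith
  have "(i + 1) mod ?n \<noteq> j"
    using i n by (auto simp: j_def mod_if)
  then have "p ! ((i + 1) mod ?n) \<noteq> p ! j"
    using d j(1) k by (simp add: nth_eq_iff_index_eq)
  moreover have "{v, p ! j} \<in> edges G"
    using e[OF j(1)] i j by (simp add: insert_commute)
  moreover have "{v, p ! ((i + 1) mod ?n)} \<in> edges G"
    using e[OF i(1)] i by simp
  ultimately show thesis
    using that j(1) k by simp
qed

text \<open>Numbering the edges lets a formula in the index describe the arcs, and crossings need
  checking only for \<open>k < l\<close>.\<close>

lemma planarI_indexed:
  fixes pos :: "'a \<Rightarrow> complex" and \<eta> :: "nat \<Rightarrow> real \<Rightarrow> complex"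
  assumes "inj_on pos (verts G)" and edges: "edges G = E ` K" and "inj_on E K"
    and arc: "\<And>k. k \<in> K \<Longrightarrow> arc (\<eta> k)"
    and ends: "\<And>k. k \<in> K \<Longrightarrow> {pathstart (\<eta> k), pathfinish (\<eta> k)} = pos ` E k"
    and vertex: "\<And>k v. \<lbrakk>k \<in> K; v \<in> verts G; pos v \<in> path_image (\<eta> k)\<rbrakk> \<Longrightarrow> v \<in> E k"
    and subset: "\<And>k. k \<in> K \<Longrightarrow> E k \<subseteq> verts G"
    and disjoint: "\<And>k l. \<lbrakk>k \<in> K; l \<in> K; k < l\<rbrakk> \<Longrightarrow>
      path_image (\<eta> k) \<inter> path_image (\<eta> l) \<subseteq> pos ` (E k \<inter> E l)"
  shows "planar G"
proof -
  define \<gamma> where "\<gamma> e = \<eta> (inv_into K E e)" for e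
  have \<gamma>: "\<gamma> (E k) = \<eta> k" if "k \<in> K" for k
    using that assms(3) by (simp add: \<gamma>_def)
  have "path_image (\<eta> k) \<inter> pos ` verts G = pos ` E k" if "k \<in> K" for k
  proof
    show "path_image (\<eta> k) \<inter> pos ` verts G \<subseteq> pos ` E k"
      using vertex[OF that] by blast
    show "pos ` E k \<subseteq> path_image (\<eta> k) \<inter> pos ` verts G"
      using subset[OF that] ends[OF that]
      by (metis (no_types, lifting) Int_subset_iff empty_subsetI image_mono insert_subset
          pathfinish_in_path_image pathstart_in_path_image)
  qed
  moreover have "path_image (\<eta> k) \<inter> path_image (\<eta> l) \<subseteq> pos ` (E k \<inter> E l)"
    if "k \<in> K" "l \<in> K" "E k \<noteq> E l" for k l
  proof (cases k l rule: linorder_cases)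
    case greater
    then show ?thesis
      using disjoint[of l k] that by (simp add: Int_commute)
  qed (use disjoint[of k l] that in auto)
  ultimately show ?thesis
    unfolding planar_def edges using assms(1) arc ends
    by (intro exI[of _ pos] exI[of _ \<gamma>]) (simp add: \<gamma>)
qed

section \<open>The cycle with pendant edges\<close>

definition cyc_succ :: "nat \<Rightarrow> nat \<Rightarrow> nat" where
  "cyc_succ g k = (if Suc k = g then 0 else Suc k)"

text \<open>Indices below \<open>g\<close> number the cycle edges by their first end; an index
  \<open>k\<close> from \<open>g\<close> on numbers the pendant edge whose leaf is
  \<open>k\<close>.\<close>

definition sun_edge :: "nat \<Rightarrow> nat \<Rightarrow> nat set" where
  "sun_edge g k = (if k < g then {k, cyc_succ g k} else {k - g, k})"

definition sun :: "nat \<Rightarrow> nat graph" where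
  "sun g = ({..<2 * g}, sun_edge g ` {..<2 * g})"

lemma verts_sun [simp]: "verts (sun g) = {..<2 * g}"
  by (simp add: sun_def)

lemma edges_sun: "edges (sun g) = sun_edge g ` {..<2 * g}"
  by (simp add: sun_def)

lemma sun_edge_subset: "k < 2 * g \<Longrightarrow> sun_edge g k \<subseteq> {..<2 * g}"
  by (auto simp: sun_edge_def cyc_succ_def)

lemma sun_edgeI: "k < 2 * g \<Longrightarrow> sun_edge g k = e \<Longrightarrow> e \<in> edges (sun g)"
  by (auto simp: edges_sun)

lemma finite_simple_graph_sun: "g \<ge> 3 \<Longrightarrow> finite_simple_graph (sun g)"
  using sun_edge_subset
  by (fastforce simp: finite_simple_graph_def edges_sun sun_edge_def cyc_succ_def card_insert_if)

lemma bipartite_sun: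
  assumes "even g"
  shows "bipartite (sun g)"
proof -
  \<comment> \<open>Cycle vertices are coloured by parity. For even \<open>g\<close>, a leaf has the
    parity of its neighbour, so leaves are coloured the opposite way.\<close>
  let ?A = "{k. k < 2 * g \<and> (even k \<longleftrightarrow> k < g)}" and ?B = "{k. k < 2 * g \<and> (odd k \<longleftrightarrow> k < g)}"
  have "\<exists>a\<in>?A. \<exists>b\<in>?B. sun_edge g k = {a, b}" if k: "k < 2 * g" for k
  proof -
    obtain a b where ab: "sun_edge g k = {a, b}" "a \<in> ?A \<and> b \<in> ?B \<or> b \<in> ?A \<and> a \<in> ?B"
    proof (cases "k < g")
      case True
      \<comment> \<open>This serves the closing edge, which joins \<open>g - 1\<close> to the even
        vertex 0.\<close>
      have "odd k" if "Suc k = g" using assms that by auto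
      with True assms show ?thesis
        by (intro that[of k "cyc_succ g k"]) (auto simp: sun_edge_def cyc_succ_def)
    next
      case False
      with k assms show ?thesis
        by (intro that[of "k - g" k]) (auto simp: sun_edge_def)
    qed
    have "sun_edge g k = {b, a}"
      using ab(1) by (simp add: insert_commute)
    with ab show ?thesis by blast
  qed
  then show ?thesis
    unfolding bipartite_def by (intro exI[of _ ?A] exI[of _ ?B]) (auto simp: edges_sun)
qed

text \<open>A cycle avoids the leaves, which have degree one, and is then closed under
  \<open>cyc_succ\<close>, so it passes through all \<open>g\<close> remaining vertices.\<close>

lemma girth_sun:
  assumes "g \<ge> 3"
  shows "girth (sun g) = enat g"
proof (rule antisym)
  have "is_cycle (sun g) [0..<g]"
  proof -
    have "{i, (i + 1) mod g} \<in> edges (sun g)" if "i < g" for i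
      using that by (intro sun_edgeI[of i]) (auto simp: sun_edge_def cyc_succ_def)
    moreover have "(i + 1) mod g < g" for i
      using assms by simp
    ultimately show ?thesis
      using assms by (auto simp: is_cycle_def)
  qed
  then have "girth (sun g) \<le> enat (length [0..<g])"
    unfolding girth_def by (intro INF_lower) simp
  then show "girth (sun g) \<le> enat g" by simp
next
  have "g \<le> length p" if p: "is_cycle (sun g) p" for p
  proof -
    have less: "v < g" if v: "v \<in> set p" for v
    proof (rule ccontr)
      assume "\<not> v < g"
      then have "a = v - g" if "{v, a} \<in> edges (sun g)" for a
        using that assms
        by (auto simp: edges_sun sun_edge_def cyc_succ_def doubleton_eq_iff split: if_splits)
      then show False
        using is_cycle_two_neighbours[OF p v] by metis
    qed
    have succ: "cyc_succ g v \<in> set p" if v: "v \<in> set p" for v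
    proof -
      obtain a b where ab: "a \<noteq> b" "a \<in> set p" "b \<in> set p"
        "{v, a} \<in> edges (sun g)" "{v, b} \<in> edges (sun g)"
        using is_cycle_two_neighbours[OF p v] .
      have "a = cyc_succ g v \<or> v = cyc_succ g a"
        if "a \<in> set p" "{v, a} \<in> edges (sun g)" for a
        using that less[OF v] less[of a]
        by (auto simp: edges_sun sun_edge_def doubleton_eq_iff split: if_splits)
      \<comment> \<open>If neither neighbour were the successor of \<open>v\<close>, then
        \<open>v\<close> would be the successor of both, against injectivity.\<close>
      moreover have "a = b" if "cyc_succ g a = cyc_succ g b"
        using that by (auto simp: cyc_succ_def split: if_splits)
      ultimately show ?thesis
        using ab by metis
    qed
    obtain u where u: "u \<in> set p"
      using p by (cases p) (auto simp: is_cycle_def)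
    have Suc: "Suc v \<in> set p" if "v \<in> set p" "Suc v < g" for v
      using succ[of v] that by (simp add: cyc_succ_def)
    \<comment> \<open>Successors climb from \<open>u\<close> to \<open>g - 1\<close>, wrap around to
      0, and climb again through every vertex below \<open>g\<close>.\<close>
    have "u + d < g \<Longrightarrow> u + d \<in> set p" for d
      using u by (induction d) (auto intro: Suc)
    from this[of "g - 1 - u"] have "g - 1 \<in> set p"
      using less[OF u] by simp
    from succ[OF this] have "0 \<in> set p"
      using assms by (simp add: cyc_succ_def)
    then have "d < g \<Longrightarrow> d \<in> set p" for d
      by (induction d) (auto intro: Suc)
    then have "card {..<g} \<le> card (set p)"
      by (intro card_mono) auto
    also have "\<dots> \<le> length p"
      by (rule card_length)
    finally show ?thesis by simp
  qed
  then show "enat g \<le> girth (sun g)"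
    unfolding girth_def by (intro INF_greatest) simp
qed

section \<open>A drawing on two concentric circles, with angles in units of 1/g of a turn\<close>

definition polar :: "nat \<Rightarrow> real \<Rightarrow> real \<Rightarrow> complex" where
  "polar g r u = of_real r * cis (2 * pi * u / g)"

text \<open>Norms give \<open>r = s\<close>, and the angles differ by \<open>n\<close> full turns,
  that is \<open>u - v = n * g\<close> with n in {-1, 0, 1}. The interval is closed because the last
  cycle arc ends at coordinate \<open>g\<close>.\<close>

lemma polar_eqD:
  assumes eq: "polar g r u = polar g s v" and "r > 0" "s > 0" "g > 0"
    and u: "0 \<le> u" "u \<le> g" and v: "0 \<le> v" "v \<le> g"
  shows "r = s \<and> (u = v \<or> u = v + g \<or> v = u + g)"
proof -
  have "norm (polar g r u) = r" "norm (polar g s v) = s"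
    using assms(2,3) by (simp_all add: polar_def norm_mult)
  with eq have rs: "r = s" by simp
  then have "cis (2 * pi * u / g) = cis (2 * pi * v / g)"
    using eq assms(2) by (simp add: polar_def)
  then have "sin (2 * pi * u / g) = sin (2 * pi * v / g) \<and>
      cos (2 * pi * u / g) = cos (2 * pi * v / g)"
    by (simp add: complex_eq_iff)
  then obtain n :: int where "2 * pi * u / g = 2 * pi * v / g + 2 * pi * n"
    unfolding sin_cos_eq_iff by auto
  then have "2 * pi * u = 2 * pi * (v + n * g)"
    using assms(4) by (simp add: field_simps)
  then have n: "u = v + real_of_int n * real g" by simp
  with u v have "\<bar>real_of_int n * real g\<bar> \<le> 1 * real g" by linarith
  then have "\<bar>real_of_int n\<bar> \<le> 1"
    using assms(4) by (simp add: abs_mult)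
  then have "n = -1 \<or> n = 0 \<or> n = 1" by linarith
  with n rs show ?thesis by auto
qed

lemma polar_add_g: "g > 0 \<Longrightarrow> polar g r (u + g) = polar g r u"
  by (simp add: polar_def distrib_left add_divide_distrib flip: cis_mult)

definition sun_pos :: "nat \<Rightarrow> nat \<Rightarrow> complex" where
  "sun_pos g k = (if k < g then polar g 1 k else polar g 2 (k - g))"

text \<open>Cycle edges become arcs of the unit circle, pendant edges radial segments from radius 1
  to radius 2.\<close>

definition sun_arc :: "nat \<Rightarrow> nat \<Rightarrow> real \<Rightarrow> complex" where
  "sun_arc g k t = (if k < g then polar g 1 (k + t) else polar g (1 + t) (k - g))"


lemma sun_pos_cyc_succ:
  assumes "k < g"
  shows "sun_pos g (cyc_succ g k) = polar g 1 (k + 1)"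
  using assms polar_add_g[of g 1 0]
  by (auto simp: sun_pos_def cyc_succ_def add.commute)

lemma arc_sun_arc:
  assumes "g \<ge> 2" "k < 2 * g"
  shows "arc (sun_arc g k)"
proof -
  have "continuous_on {0..1} (sun_arc g k)"
    unfolding sun_arc_def polar_def cis_conv_exp
    by (cases "k < g") (auto intro!: continuous_intros)
  moreover have "s = t" if "s \<in> {0..1}" "t \<in> {0..1}" "sun_arc g k s = sun_arc g k t" for s t
  proof (cases "k < g")
    case True
    have "real k + 1 \<le> g" using True by linarith
    then show ?thesis
      using polar_eqD[of g 1 "k + s" 1 "k + t"] that assms(1) True
      by (auto simp: sun_arc_def)
  next
    case False
    then show ?thesis
      using polar_eqD[of g "1 + s" "k - g" "1 + t" "k - g"] that assms
      by (auto simp: sun_arc_def)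
  qed
  ultimately show ?thesis
    by (auto simp: arc_def path_def inj_on_def)
qed

lemma planar_sun:
  assumes g: "g \<ge> 3"
  shows "planar (sun g)"
proof (rule planarI_indexed[where pos = "sun_pos g" and \<eta> = "sun_arc g" and E = "sun_edge g"
      and K = "{..<2 * g}"])
  \<comment> \<open>This keeps \<open>k + t\<close> within the range that \<open>polar_eqD\<close>
    requires.\<close>
  have succ_le: "real k + 1 \<le> g" if "k < g" for k
    using that by linarith
  show "inj_on (sun_pos g) (verts (sun g))"
  proof (rule inj_onI)
    fix k l assume kl: "k \<in> verts (sun g)" "l \<in> verts (sun g)" "sun_pos g k = sun_pos g l"
    define r u where "r k = (if k < g then 1 else 2 :: real)" and
      "u k = (if k < g then k else k - g)" for k
    have u: "u k < g" "u l < g" using kl by (auto simp: u_def)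
    have "polar g (r k) (u k) = polar g (r l) (u l)"
      using kl(3) by (auto simp: sun_pos_def r_def u_def of_nat_diff split: if_splits)
    then have "r k = r l \<and>
        (real (u k) = u l \<or> real (u k) = u l + real g \<or> real (u l) = u k + real g)"
      using u g by (intro polar_eqD) (auto simp: r_def)
    then have "r k = r l" "u k = u l"
      using u by auto
    then show "k = l" by (auto simp: r_def u_def split: if_splits)
  qed
  show "edges (sun g) = sun_edge g ` {..<2 * g}"
    by (rule edges_sun)
  show "inj_on (sun_edge g) {..<2 * g}"
    using g by (auto simp: inj_on_def sun_edge_def cyc_succ_def doubleton_eq_iff split: if_splits)
  fix k assume "k \<in> {..<2 * g}"
  then have k: "k < 2 * g" by simp
  show "arc (sun_arc g k)"
    using arc_sun_arc g k by simp
  show "{pathstart (sun_arc g k), pathfinish (sun_arc g k)} = sun_pos g ` sun_edge g k"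
  proof (cases "k < g")
    case True
    then have "pathstart (sun_arc g k) = sun_pos g k"
      "pathfinish (sun_arc g k) = sun_pos g (cyc_succ g k)"
      by (simp_all only: sun_pos_cyc_succ)
        (simp_all add: pathstart_def pathfinish_def sun_arc_def sun_pos_def add.commute)
    with True show ?thesis by (simp add: sun_edge_def)
  next
    case False
    with k show ?thesis
      by (auto simp: pathstart_def pathfinish_def sun_arc_def sun_edge_def sun_pos_def of_nat_diff)
  qed
  show "sun_edge g k \<subseteq> verts (sun g)"
    using sun_edge_subset[OF k] by simp
  show "v \<in> sun_edge g k"
    if v: "v \<in> verts (sun g)" "sun_pos g v \<in> path_image (sun_arc g k)" for v
  proof -
    obtain t where t: "0 \<le> t" "t \<le> 1" "sun_pos g v = sun_arc g k t"
      using v(2) by (auto simp: path_image_def)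
    show ?thesis
    proof (cases "v < g")
      case vg: True
      show ?thesis
      proof (cases "k < g")
        case True
        have "real v = k + t \<or> real v = k + t + g \<or> k + t = real v + g"
          using polar_eqD[of g 1 v 1 "k + t"] t vg True g succ_le[OF True]
          by (auto simp: sun_pos_def sun_arc_def)
        \<comment> \<open>As \<open>v\<close> is an integer, \<open>t\<close> is 0 or 1; the last
          alternative is the end of the closing edge.\<close>
        then have "v = k \<or> v = k + 1 \<or> v = 0 \<and> k + 1 = g"
          using t vg True by linarith
        then show ?thesis
          using vg True by (auto simp: sun_edge_def cyc_succ_def)
      next
        case False
        have "real v = real (k - g) \<or> real v = real (k - g) + g \<or> real (k - g) = real v + g"
          using polar_eqD[of g 1 v "1 + t" "k - g"] t vg False g k
          by (auto simp: sun_pos_def sun_arc_def)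
        then have "v = k - g" using vg k by linarith
        then show ?thesis using False by (simp add: sun_edge_def)
      qed
    next
      case vg: False
      show ?thesis
      proof (cases "k < g")
        case True
        then show ?thesis
          using polar_eqD[of g 2 "v - g" 1 "k + t"] t vg g v(1) succ_le[OF True]
          by (auto simp: sun_pos_def sun_arc_def)
      next
        case False
        have "real (v - g) = real (k - g) \<or> real (v - g) = real (k - g) + g \<or>
            real (k - g) = real (v - g) + g"
          using polar_eqD[of g 2 "v - g" "1 + t" "k - g"] t vg False g k v(1)
          by (auto simp: sun_pos_def sun_arc_def)
        then have "v = k" using vg False k v(1) by auto
        then show ?thesis using False by (simp add: sun_edge_def)
      qed
    qed
  qed
  fix l assume "l \<in> {..<2 * g}" and kl: "k < l"
  then have l: "l < 2 * g" by simp
  show "path_image (sun_arc g k) \<inter> path_image (sun_arc g l) \<subseteq>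
      sun_pos g ` (sun_edge g k \<inter> sun_edge g l)"
  proof
    fix z assume "z \<in> path_image (sun_arc g k) \<inter> path_image (sun_arc g l)"
    then obtain s t where s: "0 \<le> s" "s \<le> 1" "z = sun_arc g k s"
      and t: "0 \<le> t" "t \<le> 1" "z = sun_arc g l t"
      by (auto simp: path_image_def)
    have "\<exists>v \<in> sun_edge g k \<inter> sun_edge g l. z = sun_pos g v"
    proof (cases "l < g")
      case lg: True
      with kl have kg: "k < g" by simp
      have "real k + s = l + t \<or> k + s = real l + t + g \<or> real l + t = k + s + g"
        using polar_eqD[of g 1 "k + s" 1 "l + t"] s t g kg lg succ_le[OF kg] succ_le[OF lg]
        by (auto simp: sun_arc_def)
      \<comment> \<open>Two cycle arcs with \<open>k < l\<close> meet only if they are consecutive,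
        either directly or across the point of vertex 0.\<close>
      then have "l = k + 1 \<and> t = 0 \<or> k = 0 \<and> s = 0 \<and> l + 1 = g"
        using s t kl lg by linarith
      then show ?thesis
      proof (elim disjE conjE)
        assume "l = k + 1" "t = 0"
        then show ?thesis
          using t lg kg by (intro bexI[of _ l])
            (auto simp: sun_edge_def cyc_succ_def sun_arc_def sun_pos_def)
      next
        assume "k = 0" "s = 0" "l + 1 = g"
        then show ?thesis
          using s lg kg by (intro bexI[of _ 0])
            (auto simp: sun_edge_def cyc_succ_def sun_arc_def sun_pos_def)
      qed
    next
      case lg: False
      show ?thesis
      proof (cases "k < g")
        case kg: True
        \<comment> \<open>The radial segment touches the unit circle only at its start, which is the
          vertex \<open>l - g\<close>.\<close>
        have "1 = 1 + t \<and> (real k + s = real (l - g) \<or> k + s = real (l - g) + g \<or>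
            real (l - g) = k + s + g)"
          using s t g kg lg l succ_le[OF kg]
          by (intro polar_eqD) (auto simp: sun_arc_def)
        then have "t = 0" and "l - g = k \<or> l - g = k + 1 \<or> l - g = 0 \<and> k + 1 = g"
          using s kg l lg by linarith+
        then have "l - g \<in> sun_edge g k"
          using l lg kg by (auto simp: sun_edge_def cyc_succ_def)
        moreover have "z = sun_pos g (l - g)"
          using t(3) \<open>t = 0\<close> l lg by (auto simp: sun_arc_def sun_pos_def of_nat_diff)
        ultimately show ?thesis
          using lg by (auto simp: sun_edge_def)
      next
        case kg: False
        \<comment> \<open>Radial segments of different leaves have different angles, so this case is
          contradictory.\<close>
        have "1 + s = 1 + t \<and> (real (k - g) = real (l - g) \<or> real (k - g) = real (l - g) + g \<or>
            real (l - g) = real (k - g) + g)"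
          using s t g kg lg l k by (intro polar_eqD) (auto simp: sun_arc_def)
        then show ?thesis
          using kl kg lg k l by auto
      qed
    qed
    then show "z \<in> sun_pos g ` (sun_edge g k \<inter> sun_edge g l)" by blast
  qed
qed

section \<open>Two orientations at distance at least three\<close>

text \<open>The reference orientation, with \<open>F = {}\<close>, points every edge to its larger
  end; \<open>F\<close> collects the edges reversed against it.\<close>

definition reoriented :: "nat graph \<Rightarrow> nat set set \<Rightarrow> (nat \<times> nat) set" where
  "reoriented G F = {(u, v). {u, v} \<in> edges G \<and> (u < v \<longleftrightarrow> {u, v} \<notin> F)}"

lemma orientation_reoriented:
  assumes "\<And>e. e \<in> edges G \<Longrightarrow> card e = 2"
  shows "orientation G (reoriented G F)"
proof -
  have "u \<noteq> v" if "{u, v} \<in> edges G" for u v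
    using assms[OF that] by auto
  then show ?thesis
    unfolding orientation_def reoriented_def
    by (auto simp: insert_commute not_less_iff_gr_or_eq)
qed

text \<open>Two reversals of an edge cancel, so the condition on \<open>X\<close> and
  \<open>Y\<close> is an exclusive or.\<close>

lemma inversion_reorientedD:
  assumes "inversion Y (inversion X (reoriented G {})) = reoriented G F"
    and "{u, v} \<in> edges G" "u \<noteq> v"
  shows "{u, v} \<in> F \<longleftrightarrow> ({u, v} \<subseteq> X \<longleftrightarrow> \<not> {u, v} \<subseteq> Y)"
proof -
  have *: "{a, b} \<in> F \<longleftrightarrow> ({a, b} \<subseteq> X \<longleftrightarrow> \<not> {a, b} \<subseteq> Y)" if "a < b" "{a, b} \<in> edges G" for a b
  proof -
    have "(a, b) \<in> inversion Y (inversion X (reoriented G {})) \<longleftrightarrow> (a, b) \<in> reoriented G F"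
      using assms(1) by simp
    then show ?thesis
      using that by (auto simp: inversion_def reoriented_def insert_commute split: if_splits)
  qed
  show ?thesis
    using *[of u v] *[of v u] assms(2,3)
    by (cases u v rule: linorder_cases) (simp_all add: insert_commute)
qed

text \<open>The indices from \<open>g - 1\<close> on are those of the closing edge and of all
  pendant edges; every other cycle edge keeps its direction.\<close>

lemma inversions_sun:
  assumes "even g" "g \<ge> 3"
  shows "inversion Y (inversion X (reoriented (sun g) {})) \<noteq>
    reoriented (sun g) (sun_edge g ` {g - 1..<2 * g})"
proof
  let ?F = "sun_edge g ` {g - 1..<2 * g}"
  assume eq: "inversion Y (inversion X (reoriented (sun g) {})) = reoriented (sun g) ?F"
  have flip: "({u, v} \<subseteq> X \<longleftrightarrow> \<not> {u, v} \<subseteq> Y) \<longleftrightarrow> g - 1 \<le> k"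
    if k: "k < 2 * g" "sun_edge g k = {u, v}" "u \<noteq> v" for k u v
  proof -
    \<comment> \<open>For \<open>g\<close> at least 3 the edge numbering is injective, so membership
      can be read off the index.\<close>
    have "sun_edge g k \<in> ?F \<longleftrightarrow> g - 1 \<le> k"
      using k(1) assms(2)
      by (auto simp: sun_edge_def cyc_succ_def doubleton_eq_iff split: if_splits)
    then show ?thesis
      using inversion_reorientedD[OF eq, of u v] k sun_edgeI[OF k(1,2)] by simp
  qed
  have cover: "i \<in> X \<or> i \<in> Y" if "i < g" for i
    using flip[of "g + i" i "g + i"] that by (auto simp: sun_edge_def)
  \<comment> \<open>An unreversed edge lies inside both sets or inside neither. In the first case
    all four memberships hold; in the second, \<open>cover\<close> puts each end in exactly one set,
    and not both ends in the same one.\<close>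
  have swap: "(Suc i \<in> X \<longleftrightarrow> i \<in> Y) \<and> (Suc i \<in> Y \<longleftrightarrow> i \<in> X)" if "Suc i < g" for i
    using flip[of i i "Suc i"] cover[of i] cover[of "Suc i"] that
    by (auto simp: sun_edge_def cyc_succ_def)
  have "i < g \<Longrightarrow> if even i then (i \<in> X \<longleftrightarrow> 0 \<in> X) \<and> (i \<in> Y \<longleftrightarrow> 0 \<in> Y)
      else (i \<in> X \<longleftrightarrow> 0 \<in> Y) \<and> (i \<in> Y \<longleftrightarrow> 0 \<in> X)" for i
    by (induction i) (use swap in \<open>auto split: if_splits\<close>)
  \<comment> \<open>Since \<open>g - 1\<close> is odd, the ends of the closing edge have swapped
    roles. So this edge lies inside \<open>X\<close> iff it lies inside \<open>Y\<close>, although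
    it should be reversed.\<close>
  from this[of "g - 1"] have "(g - 1 \<in> X \<longleftrightarrow> 0 \<in> Y) \<and> (g - 1 \<in> Y \<longleftrightarrow> 0 \<in> X)"
    using assms by auto
  moreover have "g - 1 < 2 * g"
    using assms(2) by linarith
  ultimately show False
    using flip[of "g - 1" "g - 1" 0] assms(2) by (auto simp: sun_edge_def cyc_succ_def)
qed

theorem proposition8p9:
  fixes g :: nat
  assumes "even g" and "g \<ge> 4"
  shows "\<exists>G :: nat graph.
           finite_simple_graph G \<and> bipartite G \<and> planar G \<and> girth G = enat g \<and>
           graph_diam (inversion_graph G) \<ge> 3"
proof (intro exI conjI)
  have g: "g \<ge> 3" using assms(2) by simp
  show fin: "finite_simple_graph (sun g)"
    using finite_simple_graph_sun[OF g] .
  show "bipartite (sun g)" "planar (sun g)" "girth (sun g) = enat g"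
    using bipartite_sun planar_sun girth_sun assms(1) g by auto
  let ?D = "reoriented (sun g) {}"
  let ?D' = "reoriented (sun g) (sun_edge g ` {g - 1..<2 * g})"
  have verts: "reoriented (sun g) F \<in> verts (inversion_graph (sun g))" for F
    using orientation_reoriented[of "sun g" F] fin
    by (simp add: inversion_graph_def finite_simple_graph_def)
  have "3 \<le> graph_dist (inversion_graph (sun g)) ?D ?D'"
    using inversions_sun assms(1) g by (intro graph_dist_inversion_graph_ge_3) auto
  also have "\<dots> \<le> graph_diam (inversion_graph (sun g))"
    unfolding graph_diam_def by (rule SUP_upper2[OF verts SUP_upper[OF verts]])
  finally show "3 \<le> graph_diam (inversion_graph (sun g))" .
qed

end
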